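(* Suppose that the ego vehicle can sense and predict the surrounding obstacles in the sense that, in every planning iteration, for all $(i,j)\in\mathcal I\times\mathcal J$ the center $w^{\mathrm{obs}}_{i,j}$ of obstacle $i$ during $\mathcal T_j$ has a twice-differentiable probability density function $q_{i,j}:\mathcal W\to[0,\infty)$, and there is some $w^{\mathrm{obs}}_{i,j}$ sampled according to $q_{i,j}$ such that $\mathcal O^{\mathrm{obs}}_i(t)\subseteq\langle w^{\mathrm{obs}}_{i,j},\;G^{\mathrm{obs}}\rangle$ at some $t\in\mathcal T_j$, with $G^{\mathrm{obs}}$ a constant 2-row matrix. Suppose the ego vehicle starts from rest with an initial condition $z_0\in\mathcal Z_0$ at $t=0$, and let $\epsilon\in[0,1]$. If the ego vehicle performs planning and execution according to the online planning algorithm described in the context, then it is not-at-fault with a risk of collision at most $\epsilon$ for all time; that is, at every time the ego vehicle is either stopped or is executing a plan $p^*\in\mathcal P$ from an initial condition $z_0\in\mathcal Z_0$ (time being reset to $0$ at the start of that plan) for which $$\sum_{i\in\mathcal I}\sum_{j\in\mathcal J}\int_{\bigcup_{t\in\mathcal T_j}\left(\mathcal E(t,z_0,p^* )\oplus\langle0,\;G^{\mathrm{obs}}\rangle\right)}q_{i,j}(w)\,dw\le\epsilon,$$ where the $q_{i,j}$ are the obstacle predictions for that plan's horizon.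
   Context: Zonotopes: $\langle c,\;G\rangle=\{c+\sum_{k=1}^\ell\beta_kg_k\mid\beta_k\in[-1,1]\}$ for $G=[g_1,\dots,g_\ell]$; $\oplus$ is the Minkowski sum. $\mathcal W\subset\mathbb R^2$ is the world space, containing all planar sets considered. $\mathcal P\subset\mathbb R^{n_p}$ is the set of trajectory parameters, $\mathcal Z_0\subset\mathbb R^6$ the set of initial conditions. Dynamics. The state is $z=(x,y,h,u,v,r)$ (position, heading, longitudinal and lateral speed, yaw rate). It evolves as a hybrid system depending on $p\in\mathcal P$: $\dot z=f^{\mathrm{hi}}(t,z,p)$ when $u>u^{\mathrm{cri}}$; when $u\le u^{\mathrm{cri}}$, $z^{\mathrm{lo}}=(x,y,h,u)$ obeys $\dot z^{\mathrm{lo}}=f^{\mathrm{lo}}(t,z^{\mathrm{lo}},p)$ and the last two components have zero derivative. Here $u^{\mathrm{cri}}>0$ is a critical speed and $f^{\mathrm{hi}},f^{\mathrm{lo}}$ are given closed-loop vector fields (a tracking controller applied to vehicle dynamics with bounded modeling error). When $u$ crosses $u^{\mathrm{cri}}$ the state is reset, leaving $x,y,h,u$ unchanged and, when crossing from below, setting $v,r$ to the low-speed (steady-state cornering) lateral velocity and yaw rate. Each trajectory parameter defines a driving maneuver on $[0,t_m)$ followed by a contingency braking maneuver on $[t_m,t_f]$, $0\le t_m<t_f$, which brings the longitudinal speed to $0$ by time $t_f$. Time: $[0,t_f]$ is divided into intervals $\mathcal T_j=[(j-1)\Delta_t,j\Delta_t]$, $j\in\mathcal J=\{1,\dots,t_f/\Delta_t\}$,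 where $\Delta_t>0$ divides $t_f$. Occupancy: the ego footprint is $\mathcal O^{\mathrm{ego}}=[-L/2,L/2]\times[-W/2,W/2]$, and $\mathcal E(t,z_0,p)=R(h(t))\,\mathcal O^{\mathrm{ego}}+(x(t),y(t))^\top$ with $R(a)$ the rotation matrix by angle $a$ and $z$ the solution with $z(0)=z_0$ and parameter $p$. Obstacles are sets $\mathcal O^{\mathrm{obs}}_i(t)\subset\mathcal W$, $i\in\mathcal I$, $\mathcal I$ finite. Reachable sets (standing assumption): for each $j\in\mathcal J$ there is a map $\xi_j$ with $\bigcup_{t\in\mathcal T_j}\mathcal E(t,z_0,p)\subseteq\xi_j(z_0,p)$ for all $z_0\in\mathcal Z_0,p\in\mathcal P$, of the form $\xi_j(z_0,p)=\langle c_j(z_0)+A_jp,\;G_j\rangle$, with $c_j:\mathcal Z_0\to\mathbb R^2$ linear, $A_j\in\mathbb R^{2\times n_p}$, $G_j$ a 2-row matrix. Not-at-fault: starting from $z_0\in\mathcal Z_0$ with parameter $p$, the ego vehicle is not-at-fault with a risk of collision of at most $\epsilon$ if it is stopped, or if $\sum_{i}\sum_{j}\int_{\bigcup_{t\in\mathcal T_j}(\mathcal E(t,z_0,p)\oplus\langle0,\;G^{\mathrm{obs}}\rangle)}q_{i,j}(w)\,dw\le\epsilon$ while it is moving during $[0,t_f]$. Optimization problem (Opt-E), given $z_0$, $\{q_{i,j}\}$, $\epsilon$: minimize a user-specified cost $\mathrm{cost}(z_0,p)$ over $p\in\mathcal P$ subject to $$\sum_{i\in\mathcal I}\sum_{j\in\mathcal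 J}\sum_{\mathcal S\in\overline{\mathcal S}_j(z_0)}\int_{\mathcal S+A_jp}q_{i,j,\mathcal S}(w,p)\,dw\le\epsilon .$$ Here, for a fixed positive integer $k$, the zonotope $\langle c_j(z_0),\;[G_j,G^{\mathrm{obs}}]\rangle$ is covered by an axis-aligned $k\times k$ grid of equal rectangular cells; each cell is cut along the diagonal joining its upper-left and lower-right corners into two right-angled triangles (right-angle vertices at the lower-left and upper-right corners); $\overline{\mathcal S}_j(z_0)$ is the set of those triangles meeting the zonotope. For such $\mathcal S$ with right-angle vertex $w^{\mathrm{ctr}}_{\mathcal S}$, writing $w_p=w^{\mathrm{ctr}}_{\mathcal S}+A_jp$, $$q_{i,j,\mathcal S}(w,p)=q_{i,j}(w_p)+\tfrac{\partial q_{i,j}}{\partial w}(w_p)(w-w_p)+\tfrac12(w-w_p)^\top H_{\mathcal S}(w-w_p),$$ where $H_{\mathcal S}$ is the element-wise supremum of the Hessian of $q_{i,j}$ over $\mathcal S\oplus A_j\mathcal P$, computed by interval arithmetic (each entry is finite and at least the true supremum). Online planning algorithm (input $z_0\in\mathcal Z_0$, $\epsilon\in[0,1]$): 1. Obtain obstacle predictions $\{q_{i,j}\}$. Attempt to solve (Opt-E); if infeasible, terminate planning (vehicle stays at rest); otherwise let $p^*$ be a feasible solution found. 2. Loop: reset $t$ to $0$; execute $p^*$ during $[0,t_m)$ and, simultaneously, update $\{q_{i,j}\}$ (predictions for the horizon starting at the end of the current driving maneuver), predict the state $z_0$ of the ego vehicle at $t=t_m$; if $z_0\notin\mathcal Z_0$,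 leave the loop; otherwise attempt to solve (Opt-E) with the updated data; if it is infeasible or takes longer than the allotted planning time $t_{\mathrm{plan}}$, leave the loop (keeping the previous $p^*$); otherwise replace $p^*$ by the feasible solution found and repeat. 3. After leaving the loop, execute the braking maneuver of the (previous) $p^*$ during $[t_m,t_f]$, then terminate planning (the vehicle remains stopped). Standing assumptions: the vehicle state at the time a new plan begins is known when planning for it starts (state prediction is exact), and the vehicle senses all obstacles within radius greater than $(t_f+t_{\mathrm{plan}})(\nu^{\mathrm{ego}}+\nu^{\mathrm{obs}})+\tfrac12\sqrt{L^2+W^2}$ of its center of mass, where $\nu^{\mathrm{ego}},\nu^{\mathrm{obs}}$ are the maximum speeds of the ego vehicle and of the obstacles. *)

theory Defs
  imports "HOL-Analysis.Analysis" "HOL-Probability.Probability" "HOL-Library.Set_Algebras"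
begin

text \<open>A 2-row generator matrix is given by the list of its columns, so that
  \<open>[G, G']\<close> is \<open>G @ G'\<close>.  The Minkowski sum is \<open>+\<close> on sets.\<close>

type_synonym generators = "(real^2) list"

definition zonotope :: "real^2 \<Rightarrow> generators \<Rightarrow> (real^2) set" where
  "zonotope c G =
     {c + (\<Sum>k<length G. \<beta> k *\<^sub>R G ! k) |\<beta> :: nat \<Rightarrow> real. \<forall>k<length G. \<beta> k \<in> {-1..1}}"

definition gradient :: "(real^2 \<Rightarrow> real) \<Rightarrow> real^2 \<Rightarrow> real^2" where
  "gradient q w = (\<chi> a. frechet_derivative q (at w) (axis a 1))"

definition hessian :: "(real^2 \<Rightarrow> real) \<Rightarrow> real^2 \<Rightarrow> real^2^2" where
  "hessian q w = matrix (frechet_derivative (gradient q) (at w))"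

definition twice_differentiable_on :: "(real^2 \<Rightarrow> real) \<Rightarrow> (real^2) set \<Rightarrow> bool" where
  "twice_differentiable_on q S \<longleftrightarrow>
     (\<forall>w\<in>S. q differentiable (at w) \<and> gradient q differentiable (at w))"

text \<open>A right-angled triangle with axis-parallel legs: right-angle vertex and vector of signed
  leg lengths.\<close>

type_synonym triangle = "(real^2) \<times> (real^2)"

definition tri_region :: "triangle \<Rightarrow> (real^2) set" where
  "tri_region T = (case T of (w, l) \<Rightarrow>
     convex hull {w, w + vector [l $ 1, 0], w + vector [0, l $ 2]})"

text \<open>States are \<open>(x, y, h, u, v, r)\<close>, low-speed states \<open>(x, y, h, u)\<close>.  The type \<open>'i\<close> indexes
  all obstacles in the world and \<open>obs_index\<close> is the set of those taken into account.
  Obstacle positions are given in absolute time, everything else in the time of the current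
  plan.  \<open>sol t z p\<close> is the state at time \<open>t\<close> of the solution from \<open>z\<close> under parameter \<open>p\<close>.\<close>

record ('n, 'i) ego_system =
  t_m :: real
  t_f :: real
  dt :: real
  t_plan :: real
  u_cri :: real
  f_hi :: "real \<Rightarrow> real^6 \<Rightarrow> real^'n \<Rightarrow> real^6"
  f_lo :: "real \<Rightarrow> real^4 \<Rightarrow> real^'n \<Rightarrow> real^4"
  vr_lo :: "real \<Rightarrow> real^4 \<Rightarrow> real^'n \<Rightarrow> real \<times> real"
  sol :: "real \<Rightarrow> real^6 \<Rightarrow> real^'n \<Rightarrow> real^6"
  params :: "(real^'n) set"
  inits :: "(real^6) set"
  veh_length :: real
  veh_width :: real
  world :: "(real^2) set"
  obs_index :: "'i set"
  obstacle :: "'i \<Rightarrow> real \<Rightarrow> (real^2) set"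
  G_obs :: generators
  reach_c :: "nat \<Rightarrow> real^6 \<Rightarrow> real^2"
  reach_A :: "nat \<Rightarrow> real^'n^2"
  reach_G :: "nat \<Rightarrow> generators"
  grid_num :: nat
  grid_origin :: "nat \<Rightarrow> real^6 \<Rightarrow> real^2"
  grid_cell :: "nat \<Rightarrow> real^6 \<Rightarrow> real^2"
  cost :: "real^6 \<Rightarrow> real^'n \<Rightarrow> real"
  nu_ego :: real
  nu_obs :: real
  sense_radius :: real

definition time_index :: "('n::finite, 'i) ego_system \<Rightarrow> nat set" where
  "time_index E = {1..nat \<lfloor>t_f E / dt E\<rfloor>}"

definition time_interval :: "('n::finite, 'i) ego_system \<Rightarrow> nat \<Rightarrow> real set" where
  "time_interval E j = {(real j - 1) * dt E .. real j * dt E}"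

definition timing :: "('n::finite, 'i) ego_system \<Rightarrow> bool" where
  "timing E \<longleftrightarrow> 0 \<le> t_m E \<and> t_m E < t_f E \<and> 0 < dt E \<and> t_f E / dt E \<in> \<nat>"

definition speed :: "real^6 \<Rightarrow> real" where
  "speed z = z $ 4"

definition lo_state :: "real^6 \<Rightarrow> real^4" where
  "lo_state z = vector [z $ 1, z $ 2, z $ 3, z $ 4]"

definition lo_field :: "real^4 \<Rightarrow> real^6" where
  "lo_field f = vector [f $ 1, f $ 2, f $ 3, f $ 4, 0, 0]"

definition crosses_from_below :: "real \<Rightarrow> (real \<Rightarrow> real) \<Rightarrow> real \<Rightarrow> bool" where
  "crosses_from_below a u t \<longleftrightarrow> u t = a \<and>
     (\<forall>\<^sub>F s in at_left t. u s \<le> a) \<and> (\<forall>\<^sub>F s in at_right t. u s > a)"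

text \<open>At a reset time the value of the trajectory is the post-reset state.  The finite exceptional
  set of the differential equation accommodates the reset times and discontinuities of the closed
  loop in time, such as the switch to the braking maneuver at \<open>t_m\<close>.  A downward crossing of
  \<open>u_cri\<close> leaves the whole state unchanged.\<close>

definition hybrid_solution ::
  "('n::finite, 'i) ego_system \<Rightarrow> real^'n \<Rightarrow> (real \<Rightarrow> real^6) \<Rightarrow> bool" where
  "hybrid_solution E p z \<longleftrightarrow>
     (\<forall>k\<in>{1, 2, 3, 4}. continuous_on {0..t_f E} (\<lambda>t. z t $ k)) \<and>
     (\<exists>D. finite D \<and> (\<forall>t\<in>{0<..<t_f E} - D.
        (z has_vector_derivative
           (if speed (z t) > u_cri E then f_hi E t (z t) p
            else lo_field (f_lo E t (lo_state (z t)) p))) (at t))) \<and>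
     (\<forall>t\<in>{0..<t_f E}. (z \<longlongrightarrow> z t) (at_right t)) \<and>
     (\<forall>t\<in>{0<..t_f E}.
        if crosses_from_below (u_cri E) (\<lambda>s. speed (z s)) t
        then (z t $ 5, z t $ 6) = vr_lo E t (lo_state (z t)) p
        else (z \<longlongrightarrow> z t) (at_left t))"

definition stopped :: "real^6 \<Rightarrow> bool" where
  "stopped z \<longleftrightarrow> speed z = 0"

definition dynamics :: "('n::finite, 'i) ego_system \<Rightarrow> bool" where
  "dynamics E \<longleftrightarrow> 0 < u_cri E \<and>
     (\<forall>z0\<in>inits E. \<forall>p\<in>params E.
        sol E 0 z0 p = z0 \<and> hybrid_solution E p (\<lambda>t. sol E t z0 p) \<and>
        stopped (sol E (t_f E) z0 p))"

definition position :: "real^6 \<Rightarrow> real^2" where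
  "position z = vector [z $ 1, z $ 2]"

definition rotation :: "real \<Rightarrow> real^2^2" where
  "rotation a = vector [vector [cos a, - sin a], vector [sin a, cos a]]"

definition footprint :: "('n::finite, 'i) ego_system \<Rightarrow> (real^2) set" where
  "footprint E = {w. w $ 1 \<in> {- veh_length E / 2 .. veh_length E / 2} \<and>
                     w $ 2 \<in> {- veh_width E / 2 .. veh_width E / 2}}"

definition occupancy :: "('n::finite, 'i) ego_system \<Rightarrow> real \<Rightarrow> real^6 \<Rightarrow> real^'n \<Rightarrow> (real^2) set" where
  "occupancy E t z0 p =
     (\<lambda>w. rotation (sol E t z0 p $ 3) *v w + position (sol E t z0 p)) ` footprint E"

definition reach_set :: "('n::finite, 'i) ego_system \<Rightarrow> nat \<Rightarrow> real^6 \<Rightarrow> real^'n \<Rightarrow> (real^2) set" where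
  "reach_set E j z0 p = zonotope (reach_c E j z0 + reach_A E j *v p) (reach_G E j)"

definition reachability :: "('n::finite, 'i) ego_system \<Rightarrow> bool" where
  "reachability E \<longleftrightarrow> (\<forall>j\<in>time_index E. linear (reach_c E j) \<and>
     (\<forall>z0\<in>inits E. \<forall>p\<in>params E.
        (\<Union>t\<in>time_interval E j. occupancy E t z0 p) \<subseteq> reach_set E j z0 p))"

definition collision_risk ::
  "('n::finite, 'i) ego_system \<Rightarrow> ('i \<Rightarrow> nat \<Rightarrow> real^2 \<Rightarrow> real) \<Rightarrow> real^6 \<Rightarrow> real^'n \<Rightarrow> real" where
  "collision_risk E q z0 p = (\<Sum>i\<in>obs_index E. \<Sum>j\<in>time_index E.
     LINT w : (\<Union>t\<in>time_interval E j. occupancy E t z0 p + zonotope 0 (G_obs E)) | lborel. q i j w)"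

text \<open>Each cell is split into a triangle with its right angle at the lower-left corner and one with
  its right angle at the upper-right corner.\<close>

definition grid_triangles :: "nat \<Rightarrow> real^2 \<Rightarrow> real^2 \<Rightarrow> triangle set" where
  "grid_triangles k c d =
     (\<Union>a\<in>{..<k}. \<Union>b\<in>{..<k}.
        {(c + vector [real a * d $ 1, real b * d $ 2], d),
         (c + vector [real (Suc a) * d $ 1, real (Suc b) * d $ 2], - d)})"

definition cover_triangles :: "('n::finite, 'i) ego_system \<Rightarrow> nat \<Rightarrow> real^6 \<Rightarrow> triangle set" where
  "cover_triangles E j z0 =
     {T \<in> grid_triangles (grid_num E) (grid_origin E j z0) (grid_cell E j z0).
        tri_region T \<inter> zonotope (reach_c E j z0) (reach_G E j @ G_obs E) \<noteq> {}}"

text \<open>Cells are allowed to be degenerate because a bounding-box grid of a degenerate zonotope is.\<close>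

definition grids_cover :: "('n::finite, 'i) ego_system \<Rightarrow> bool" where
  "grids_cover E \<longleftrightarrow> 0 < grid_num E \<and>
     (\<forall>j\<in>time_index E. \<forall>z0\<in>inits E.
        0 \<le> grid_cell E j z0 $ 1 \<and> 0 \<le> grid_cell E j z0 $ 2 \<and>
        zonotope (reach_c E j z0) (reach_G E j @ G_obs E)
          \<subseteq> cbox (grid_origin E j z0)
                 (grid_origin E j z0 + real (grid_num E) *\<^sub>R grid_cell E j z0))"

definition quadratic_bound ::
  "(real^2 \<Rightarrow> real) \<Rightarrow> real^2^2 \<Rightarrow> real^2 \<Rightarrow> real^2 \<Rightarrow> real" where
  "quadratic_bound q H wp w =
     q wp + gradient q wp \<bullet> (w - wp) + 1 / 2 * ((w - wp) \<bullet> (H *v (w - wp)))"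

record 'x opt_problem =
  objective :: "'x \<Rightarrow> real"
  feasible_set :: "'x set"

definition opt_E ::
  "('n::finite, 'i) ego_system \<Rightarrow> real \<Rightarrow> ('i \<Rightarrow> nat \<Rightarrow> real^2 \<Rightarrow> real) \<Rightarrow>
   ('i \<Rightarrow> nat \<Rightarrow> triangle \<Rightarrow> real^2^2) \<Rightarrow> real^6 \<Rightarrow> (real^'n) opt_problem" where
  "opt_E E \<epsilon> q H z0 = \<lparr>
     objective = cost E z0,
     feasible_set = {p \<in> params E.
       (\<Sum>i\<in>obs_index E. \<Sum>j\<in>time_index E. \<Sum>T\<in>cover_triangles E j z0.
          LINT w : (\<lambda>x. x + reach_A E j *v p) ` tri_region T | lborel.
            quadratic_bound (q i j) (H i j T) (fst T + reach_A E j *v p) w) \<le> \<epsilon>}\<rparr>"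

text \<open>The differentiability domain of the densities is open, and it contains all planar sets on which
  they are evaluated as well as the obstacles.\<close>

definition world_space :: "('n::finite, 'i) ego_system \<Rightarrow> bool" where
  "world_space E \<longleftrightarrow> open (world E) \<and>
     (\<forall>i\<in>obs_index E. \<forall>\<tau>\<ge>0. obstacle E i \<tau> \<subseteq> world E) \<and>
     (\<forall>z0\<in>inits E. \<forall>p\<in>params E. \<forall>t\<in>{0..t_f E}.
        occupancy E t z0 p + zonotope 0 (G_obs E) \<subseteq> world E) \<and>
     (\<forall>z0\<in>inits E. \<forall>j\<in>time_index E. \<forall>T\<in>cover_triangles E j z0.
        tri_region T + (\<lambda>p. reach_A E j *v p) ` params E \<subseteq> world E)"

text \<open>A run consists of planning iterations \<open>0, 1, 2, \<dots>\<close>.  Iteration \<open>n\<close> prepares a plan that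
  would start at absolute time \<open>n * t_m\<close>, from the state \<open>predicted_state n\<close>.  Its outcome
  \<open>plan n\<close> is \<open>None\<close> if no new plan is adopted, after which no further iteration takes place.
  \<open>traj\<close> is the actual state of the vehicle in absolute time.\<close>

record ('n, 'i) planning_run =
  prediction :: "nat \<Rightarrow> 'i \<Rightarrow> nat \<Rightarrow> real^2 \<Rightarrow> real"
  hess_bound :: "nat \<Rightarrow> 'i \<Rightarrow> nat \<Rightarrow> triangle \<Rightarrow> real^2^2"
  predicted_state :: "nat \<Rightarrow> real^6"
  solve_time :: "nat \<Rightarrow> real"
  plan :: "nat \<Rightarrow> (real^'n) option"
  traj :: "real \<Rightarrow> real^6"

definition start_time :: "('n::finite, 'i) ego_system \<Rightarrow> nat \<Rightarrow> real" where
  "start_time E n = real n * t_m E"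

definition performed :: "('n::finite, 'i) planning_run \<Rightarrow> nat \<Rightarrow> bool" where
  "performed R n \<longleftrightarrow> n = 0 \<or> plan R (n - 1) \<noteq> None"

definition iteration_problem ::
  "('n::finite, 'i) ego_system \<Rightarrow> ('n, 'i) planning_run \<Rightarrow> real \<Rightarrow> nat \<Rightarrow> (real^'n) opt_problem" where
  "iteration_problem E R \<epsilon> n =
     opt_E E \<epsilon> (prediction R n) (hess_bound R n) (predicted_state R n)"

definition follows_algorithm ::
  "('n::finite, 'i) ego_system \<Rightarrow> ('n, 'i) planning_run \<Rightarrow> real \<Rightarrow> bool" where
  "follows_algorithm E R \<epsilon> \<longleftrightarrow>
     (case plan R 0 of
        None \<Rightarrow> feasible_set (iteration_problem E R \<epsilon> 0) = {}
      | Some p \<Rightarrow> p \<in> feasible_set (iteration_problem E R \<epsilon> 0)) \<and>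
     (\<forall>n. if plan R n = None then plan R (Suc n) = None
       else (case plan R (Suc n) of
           None \<Rightarrow> predicted_state R (Suc n) \<notin> inits E \<or>
                   feasible_set (iteration_problem E R \<epsilon> (Suc n)) = {} \<or>
                   solve_time R (Suc n) > t_plan E
         | Some p \<Rightarrow> predicted_state R (Suc n) \<in> inits E \<and>
                     p \<in> feasible_set (iteration_problem E R \<epsilon> (Suc n)) \<and>
                     solve_time R (Suc n) \<le> t_plan E))"

text \<open>If no plan is adopted after plan \<open>n\<close>, then plan \<open>n\<close> is executed up to \<open>t_f\<close> and the vehicle
  stays where it has stopped.  The last clause excludes runs with \<open>t_m = 0\<close> that loop forever
  without time advancing.\<close>

definition vehicle_motion ::
  "('n::finite, 'i) ego_system \<Rightarrow> ('n, 'i) planning_run \<Rightarrow> bool" where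
  "vehicle_motion E R \<longleftrightarrow>
     (plan R 0 = None \<longrightarrow> (\<forall>\<tau>\<ge>0. traj R \<tau> = traj R 0)) \<and>
     (\<forall>n p. plan R n = Some p \<longrightarrow>
        (let \<tau> = start_time E n in
          (\<forall>t\<in>{0..t_m E}. traj R (\<tau> + t) = sol E t (traj R \<tau>) p) \<and>
          (plan R (Suc n) = None \<longrightarrow>
             (\<forall>t\<in>{t_m E..t_f E}. traj R (\<tau> + t) = sol E t (traj R \<tau>) p) \<and>
             (\<forall>t\<ge>t_f E. traj R (\<tau> + t) = traj R (\<tau> + t_f E))))) \<and>
     (t_m E = 0 \<longrightarrow> (\<exists>n. plan R n = None))"

definition exact_prediction ::
  "('n::finite, 'i) ego_system \<Rightarrow> ('n, 'i) planning_run \<Rightarrow> bool" where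
  "exact_prediction E R \<longleftrightarrow>
     (\<forall>n. performed R n \<longrightarrow> predicted_state R n = traj R (start_time E n))"

definition hessian_bounds ::
  "('n::finite, 'i) ego_system \<Rightarrow> ('n, 'i) planning_run \<Rightarrow> bool" where
  "hessian_bounds E R \<longleftrightarrow>
     (\<forall>n. performed R n \<and> predicted_state R n \<in> inits E \<longrightarrow>
       (\<forall>i\<in>obs_index E. \<forall>j\<in>time_index E. \<forall>T\<in>cover_triangles E j (predicted_state R n).
          \<forall>w \<in> tri_region T + (\<lambda>p. reach_A E j *v p) ` params E. \<forall>a b.
            hessian (prediction R n i j) w $ a $ b \<le> hess_bound R n i j T $ a $ b))"

text \<open>\<open>\<Omega>\<close> is the probability space on which the obstacle centers are random variables;
  a sampled center is a value of the random variable.\<close>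

definition obstacle_predictions ::
  "('n::finite, 'i) ego_system \<Rightarrow> ('n, 'i) planning_run \<Rightarrow> 'o measure \<Rightarrow>
   (nat \<Rightarrow> 'i \<Rightarrow> nat \<Rightarrow> 'o \<Rightarrow> real^2) \<Rightarrow> bool" where
  "obstacle_predictions E R \<Omega> center \<longleftrightarrow> prob_space \<Omega> \<and>
     (\<forall>n. performed R n \<longrightarrow> (\<forall>i\<in>obs_index E. \<forall>j\<in>time_index E.
        (\<forall>w\<in>world E. 0 \<le> prediction R n i j w) \<and>
        twice_differentiable_on (prediction R n i j) (world E) \<and>
        distributed \<Omega> lborel (center n i j)
          (\<lambda>w. ennreal (indicator (world E) w * prediction R n i j w)) \<and>
        (\<exists>\<omega>\<in>space \<Omega>. \<exists>t\<in>time_interval E j.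
           obstacle E i (start_time E n + t) \<subseteq> zonotope (center n i j \<omega>) (G_obs E))))"

text \<open>Speed bounds are Lipschitz bounds, for the obstacles on the motion of each of their points.
  Sensing takes place at all times.\<close>

definition sensing :: "('n::finite, 'i) ego_system \<Rightarrow> ('n, 'i) planning_run \<Rightarrow> bool" where
  "sensing E R \<longleftrightarrow>
     (\<forall>z0\<in>inits E. \<forall>p\<in>params E. \<forall>s\<in>{0..t_f E}. \<forall>t\<in>{0..t_f E}.
        dist (position (sol E s z0 p)) (position (sol E t z0 p)) \<le> nu_ego E * \<bar>s - t\<bar>) \<and>
     (\<forall>i. \<forall>s\<ge>0. \<forall>t\<ge>0. \<forall>w\<in>obstacle E i s. \<exists>w'\<in>obstacle E i t.
        dist w w' \<le> nu_obs E * \<bar>s - t\<bar>) \<and>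
     sense_radius E > (t_f E + t_plan E) * (nu_ego E + nu_obs E)
        + 1 / 2 * sqrt ((veh_length E)\<^sup>2 + (veh_width E)\<^sup>2) \<and>
     (\<forall>\<tau>\<ge>0. \<forall>i. obstacle E i \<tau> \<inter> cball (position (traj R \<tau>)) (sense_radius E) \<noteq> {}
        \<longrightarrow> i \<in> obs_index E)"

text \<open>At absolute time \<open>\<tau>\<close> the vehicle is executing plan \<open>n\<close>, that is, the parameter \<open>p\<close> from the
  initial condition \<open>z0\<close> with time reset to 0 at the start of the plan.\<close>

definition executing ::
  "('n::finite, 'i) ego_system \<Rightarrow> ('n, 'i) planning_run \<Rightarrow> real \<Rightarrow> nat \<Rightarrow> real^6 \<Rightarrow> real^'n \<Rightarrow> bool" where
  "executing E R \<tau> n z0 p \<longleftrightarrow>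
     plan R n = Some p \<and> traj R (start_time E n) = z0 \<and>
     (\<exists>t. \<tau> = start_time E n + t \<and> 0 \<le> t \<and>
          (if plan R (Suc n) = None then t \<le> t_f E else t < t_m E) \<and>
          traj R \<tau> = sol E t z0 p)"

end

theory Submission
  imports Defs
begin

text \<open>On each grid triangle both components of the displacement from the right-angle vertex have the
  same sign, so replacing the entries of the Hessian by upper bounds can only increase the quadratic
  form.  By Taylor's theorem the integrand of the constraint of (Opt-E) therefore dominates the
  density.  As the shifted triangles cover the reachable set enlarged by the obstacle generators,
  every feasible parameter has risk at most \<open>\<epsilon>\<close>.  At each time the vehicle is stopped or follows the
  last adopted plan, which is feasible for the exactly predicted state.\<close>

section \<open>Minkowski sums and translates of zonotopes\<close>

lemma sum_lessThan_add:
  fixes f :: "nat \<Rightarrow> 'a::comm_monoid_add"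
  shows "(\<Sum>k<m + n. f k) = (\<Sum>k<m. f k) + (\<Sum>k<n. f (m + k))"
  by (induction n) (simp_all add: add.assoc)

text \<open>Appending the two coefficient sequences, the second one shifted by
  \<open>length G\<close>, gives admissible coefficients for \<open>G @ G'\<close>.\<close>

lemma zonotope_add_subset: "zonotope c G + zonotope 0 G' \<subseteq> zonotope c (G @ G')"
proof
  fix x assume "x \<in> zonotope c G + zonotope 0 G'"
  then obtain \<beta> \<gamma> :: "nat \<Rightarrow> real"
    where b: "\<forall>k<length G. \<beta> k \<in> {-1..1}" and g: "\<forall>k<length G'. \<gamma> k \<in> {-1..1}"
      and x: "x = c + (\<Sum>k<length G. \<beta> k *\<^sub>R G ! k) + (0 + (\<Sum>k<length G'. \<gamma> k *\<^sub>R G' ! k))"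
    unfolding zonotope_def set_plus_def by blast
  define \<delta> where "\<delta> k = (if k < length G then \<beta> k else \<gamma> (k - length G))" for k
  have "(\<Sum>k<length (G @ G'). \<delta> k *\<^sub>R (G @ G') ! k) =
      (\<Sum>k<length G. \<delta> k *\<^sub>R (G @ G') ! k) +
      (\<Sum>k<length G'. \<delta> (length G + k) *\<^sub>R (G @ G') ! (length G + k))"
    by (simp add: sum_lessThan_add)
  also have "\<dots> = (\<Sum>k<length G. \<beta> k *\<^sub>R G ! k) + (\<Sum>k<length G'. \<gamma> k *\<^sub>R G' ! k)"
    by (simp add: \<delta>_def nth_append)
  finally have "x = c + (\<Sum>k<length (G @ G'). \<delta> k *\<^sub>R (G @ G') ! k)"
    using x by (simp add: add.assoc)
  moreover have "\<forall>k<length (G @ G'). \<delta> k \<in> {-1..1}"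
    using b g by (simp add: \<delta>_def less_diff_conv2 not_less)
  ultimately show "x \<in> zonotope c (G @ G')"
    unfolding zonotope_def by blast
qed

lemma zonotope_translate: "zonotope (c + v) G = (\<lambda>x. x + v) ` zonotope c G"
  unfolding zonotope_def by (auto simp: image_iff algebra_simps)

section \<open>Right-angled triangles and the grid covering a zonotope\<close>

text \<open>Barycentric coordinates: \<open>s\<close> and \<open>t\<close> weigh the ends of the two
  legs, \<open>1 - s - t\<close> the right-angle vertex. As the legs are parallel to the axes, each
  coordinate of \<open>x\<close> involves only one weight.\<close>

lemma tri_region_iff:
  "x \<in> tri_region (w, l) \<longleftrightarrow>
    (\<exists>s t. 0 \<le> s \<and> 0 \<le> t \<and> s + t \<le> 1 \<and> x $ 1 = w $ 1 + s * l $ 1 \<and> x $ 2 = w $ 2 + t * l $ 2)"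
  (is "_ \<longleftrightarrow> ?R")
proof
  assume "x \<in> tri_region (w, l)"
  then obtain u s t where "0 \<le> u" "0 \<le> s" "0 \<le> t" "u + s + t = 1"
    and x: "x = u *\<^sub>R w + s *\<^sub>R (w + vector [l $ 1, 0]) + t *\<^sub>R (w + vector [0, l $ 2])"
    unfolding tri_region_def prod.case convex_hull_3 by blast
  moreover from this have u: "u = 1 - s - t" by simp
  ultimately show ?R
    by (intro exI[of _ s] exI[of _ t]) (auto simp: x u algebra_simps)
next
  assume ?R
  then obtain s t where st: "0 \<le> s" "0 \<le> t" "s + t \<le> 1"
    and x: "x $ 1 = w $ 1 + s * l $ 1" "x $ 2 = w $ 2 + t * l $ 2" by blast
  have "x = (1 - s - t) *\<^sub>R w + s *\<^sub>R (w + vector [l $ 1, 0]) + t *\<^sub>R (w + vector [0, l $ 2])"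
    by (simp add: vec_eq_iff forall_2 x algebra_simps)
  moreover have "0 \<le> 1 - s - t" "(1 - s - t) + s + t = 1" using st by auto
  ultimately show "x \<in> tri_region (w, l)"
    unfolding tri_region_def prod.case convex_hull_3 using st by blast
qed

lemma vertex_in_tri_region: "fst T \<in> tri_region T"
  by (cases T) (auto simp: tri_region_iff intro!: exI[of _ 0])

lemma convex_tri_region: "convex (tri_region T)"
  by (cases T) (simp add: tri_region_def convex_convex_hull)

lemma compact_tri_region: "compact (tri_region T)"
  by (cases T) (simp add: tri_region_def finite_imp_compact_convex_hull)

text \<open>One axis of the grid: \<open>y\<close> is the offset from the grid origin,
  \<open>e\<close> the cell size, \<open>a\<close> the index of a cell containing the point and
  \<open>s\<close> the relative position inside that cell.\<close>

lemma grid_coordinate: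
  fixes y e :: real
  assumes "0 < k" "0 \<le> y" "y \<le> real k * e"
  obtains a s where "a < k" "0 \<le> s" "s \<le> 1" "y = (real a + s) * e"
proof (cases "e > 0")
  case True
  define r where "r = y / e"
  have r: "0 \<le> r" "r \<le> real k" "y = r * e"
    using assms True by (auto simp: r_def field_simps)
  show ?thesis
  proof (cases "r < real k")
    case True
    with r have "nat \<lfloor>r\<rfloor> < k" by linarith
    moreover have "0 \<le> r - real (nat \<lfloor>r\<rfloor>)" "r - real (nat \<lfloor>r\<rfloor>) \<le> 1"
      using r by linarith+
    ultimately show ?thesis using that[of "nat \<lfloor>r\<rfloor>" "r - real (nat \<lfloor>r\<rfloor>)"] r by simp
  next
    case False
    \<comment> \<open>Here \<open>y = real k * e\<close> is the far end of the grid. Rounding down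
      would give the nonexistent cell \<open>k\<close>, so the point is taken as the far end of the
      last cell.\<close>
    with r that[of "k - 1" 1] assms show ?thesis by (simp add: of_nat_diff)
  qed
next
  case False
  \<comment> \<open>In the degenerate case the bounds leave only \<open>y = 0\<close>, and cell 0
    contains it.\<close>
  then have "real k * e \<le> 0" by (simp add: mult_nonneg_nonpos)
  with assms have "y = 0" "real k * e = 0" by linarith+
  with that[of 0 0] assms show ?thesis by auto
qed

text \<open>In the relative coordinates \<open>(s, t)\<close> of a cell the cutting diagonal is the
  line \<open>s + t = 1\<close>, so comparing \<open>s + t\<close> with 1 selects the
  triangle.\<close>

lemma cbox_subset_grid_triangles:
  assumes "0 < k" "x \<in> cbox c (c + real k *\<^sub>R d)"
  obtains T where "T \<in> grid_triangles k c d" "x \<in> tri_region T"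
proof -
  have "0 \<le> x $ 1 - c $ 1" "x $ 1 - c $ 1 \<le> real k * d $ 1"
    "0 \<le> x $ 2 - c $ 2" "x $ 2 - c $ 2 \<le> real k * d $ 2"
    using assms(2) by (auto simp: mem_box_cart forall_2 algebra_simps)
  then obtain a s b t where a: "a < k" "0 \<le> s" "s \<le> 1" "x $ 1 - c $ 1 = (real a + s) * d $ 1"
    and b: "b < k" "0 \<le> t" "t \<le> 1" "x $ 2 - c $ 2 = (real b + t) * d $ 2"
    using grid_coordinate[OF assms(1)] by metis
  let ?L = "(c + vector [real a * d $ 1, real b * d $ 2], d)"
  let ?U = "(c + vector [real (Suc a) * d $ 1, real (Suc b) * d $ 2], - d)"
  have mem: "?L \<in> grid_triangles k c d" "?U \<in> grid_triangles k c d"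
    unfolding grid_triangles_def using a(1) b(1) by blast+
  show ?thesis
  proof (cases "s + t \<le> 1")
    case True
    then have "x \<in> tri_region ?L" unfolding tri_region_iff
      using a b by (intro exI[of _ s] exI[of _ t]) (simp add: algebra_simps)
    with mem that show ?thesis by blast
  next
    case False
    \<comment> \<open>Seen from the upper-right corner, with both legs reversed, the coordinates are
      \<open>1 - s\<close> and \<open>1 - t\<close>, and their sum is below 1.\<close>
    then have "x \<in> tri_region ?U" unfolding tri_region_iff
      using a b by (intro exI[of _ "1 - s"] exI[of _ "1 - t"]) (simp add: algebra_simps)
    with mem that show ?thesis by blast
  qed
qed

text \<open>The legs are given by \<open>d\<close> or by \<open>- d\<close>, so from the right-angle
  vertex both point in nonnegative or both in nonpositive axis directions. This is what the choice
  of the diagonal achieves: cutting along the other one would produce displacements of mixed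
  sign.\<close>

lemma grid_triangle_displacement:
  assumes "T \<in> grid_triangles k c d" "0 \<le> d $ 1" "0 \<le> d $ 2" "x \<in> tri_region T"
  shows "0 \<le> (x - fst T) $ a * (x - fst T) $ b"
proof -
  obtain w l where T: "T = (w, l)" by fastforce
  with assms have l: "l = d \<or> l = - d" by (auto simp: grid_triangles_def)
  obtain s t where st: "0 \<le> s" "0 \<le> t" "x $ 1 = w $ 1 + s * l $ 1" "x $ 2 = w $ 2 + t * l $ 2"
    using assms(4) unfolding T tri_region_iff by blast
  from l have "(\<forall>a. 0 \<le> (x - w) $ a) \<or> (\<forall>a. (x - w) $ a \<le> 0)"
    using assms(2,3) st by (auto simp: forall_2)
  then show ?thesis by (auto simp: T simp del: vector_minus_component
        intro: mult_nonneg_nonneg mult_nonpos_nonpos)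
qed

lemma finite_cover_triangles: "finite (cover_triangles E j z0)"
  unfolding cover_triangles_def grid_triangles_def by auto

section \<open>Quadratic forms and Taylor's theorem\<close>

text \<open>The form is the sum of the matrix entries weighted by the products
  \<open>v $ a * v $ b\<close>. Once these weights are nonnegative, an entrywise comparison suffices
  and no semidefinite ordering is involved.\<close>

lemma quadratic_form_mono:
  fixes H K :: "real^'n^'n" and v :: "real^'n"
  assumes "\<And>a b. H $ a $ b \<le> K $ a $ b" "\<And>a b. 0 \<le> v $ a * v $ b"
  shows "v \<bullet> (H *v v) \<le> v \<bullet> (K *v v)"
proof -
  have form: "v \<bullet> (M *v v) = (\<Sum>a\<in>UNIV. \<Sum>b\<in>UNIV. M $ a $ b * (v $ a * v $ b))" for M :: "real^'n^'n"
    by (simp add: inner_vec_def matrix_vector_mult_def sum_distrib_left algebra_simps)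
  show ?thesis unfolding form by (intro sum_mono mult_right_mono assms)
qed

text \<open>\<open>gradient\<close> collects the partial derivatives; linearity and expansion of
  \<open>v\<close> in the standard basis recover the whole derivative.\<close>

lemma frechet_derivative_gradient:
  assumes "q differentiable (at w)"
  shows "frechet_derivative q (at w) v = gradient q w \<bullet> v"
proof -
  interpret linear "frechet_derivative q (at w)"
    using assms by (rule linear_frechet_derivative)
  have "frechet_derivative q (at w) v = frechet_derivative q (at w) (\<Sum>a\<in>UNIV. v $ a *\<^sub>R axis a 1)"
    by (simp add: basis_expansion flip: scalar_mult_eq_scaleR)
  also have "\<dots> = gradient q w \<bullet> v"
    by (simp add: sum scaleR gradient_def inner_vec_def mult.commute)
  finally show ?thesis .
qed

text \<open>Maclaurin's theorem is applied to \<open>q\<close> along the segment, parametrized over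
  the unit interval. The Lagrange form of the remainder asks only for the existence of second
  derivatives, which is what \<open>twice_differentiable_on\<close> provides.\<close>

lemma second_order_taylor:
  assumes q: "twice_differentiable_on q S" and "closed_segment x y \<subseteq> S"
  obtains \<xi> where "\<xi> \<in> closed_segment x y" "q y = quadratic_bound q (hessian q \<xi>) x y"
proof -
  define v where "v = y - x"
  define P where "P t = x + t *\<^sub>R v" for t
  have P_in: "P t \<in> closed_segment x y" if "0 \<le> t" "t \<le> 1" for t
    using that by (auto simp: P_def v_def in_segment algebra_simps intro!: exI[of _ t])
  then have P_S: "P t \<in> S" if "0 \<le> t" "t \<le> 1" for t
    using that assms(2) by blast
  have P': "(P has_derivative (\<lambda>s. s *\<^sub>R v)) (at t)" for t
    unfolding P_def by (auto intro!: derivative_eq_intros)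
  have d1: "DERIV (\<lambda>t. q (P t)) t :> gradient q (P t) \<bullet> v" if t: "0 \<le> t" "t \<le> 1" for t
  proof -
    have "q differentiable (at (P t))"
      using q P_S[OF t] by (simp add: twice_differentiable_on_def)
    then have "(q has_derivative (\<lambda>u. gradient q (P t) \<bullet> u)) (at (P t))"
      using frechet_derivative_gradient[of q "P t"] frechet_derivative_works[of q "at (P t)"]
      by (metis (no_types, lifting) ext)
    from has_derivative_compose[OF P' this] show ?thesis
      by (simp add: has_field_derivative_def mult_commute_abs)
  qed
  have d2: "DERIV (\<lambda>t. gradient q (P t) \<bullet> v) t :> v \<bullet> (hessian q (P t) *v v)"
    if t: "0 \<le> t" "t \<le> 1" for t
  proof -
    let ?D = "frechet_derivative (gradient q) (at (P t))"
    have diff: "gradient q differentiable (at (P t))"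
      using q P_S[OF t] by (simp add: twice_differentiable_on_def)
    have "hessian q (P t) *v u = ?D u" for u
      unfolding hessian_def by (rule matrix_works) (simp add: linear_matrix_vector_mul_eq linear_frechet_derivative diff)
    then have "?D = (\<lambda>u. hessian q (P t) *v u)" by auto
    then have "(gradient q has_derivative (\<lambda>u. hessian q (P t) *v u)) (at (P t))"
      using diff frechet_derivative_works by metis
    from has_derivative_inner_left[OF has_derivative_compose[OF P' this], of v] show ?thesis
      by (simp add: has_field_derivative_def matrix_vector_mult_scaleR inner_commute mult_commute_abs)
  qed
  \<comment> \<open>Maclaurin's theorem expects a family of successive derivatives indexed by
    \<open>nat\<close>. The expansion stops at order 2, so the value at larger indices is
    arbitrary.\<close>
  define D :: "nat \<Rightarrow> real \<Rightarrow> real" where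
    "D m = (case m of 0 \<Rightarrow> \<lambda>t. q (P t) | Suc 0 \<Rightarrow> \<lambda>t. gradient q (P t) \<bullet> v
      | _ \<Rightarrow> \<lambda>t. v \<bullet> (hessian q (P t) *v v))" for m
  have "\<forall>m t. m < 2 \<and> 0 \<le> t \<and> t \<le> 1 \<longrightarrow> DERIV (D m) t :> D (Suc m) t"
    using d1 d2 by (auto simp: D_def less_2_cases_iff)
  from Maclaurin[of 1 2 D "D 0", OF _ _ refl this]
  obtain t where t: "0 < t" "t < 1"
    and "D 0 1 = (\<Sum>m<2. D m 0 / fact m * 1 ^ m) + D 2 t / fact 2 * 1 ^ 2"
    by auto
  then have "q y = quadratic_bound q (hessian q (P t)) x y"
    by (simp add: D_def P_def v_def quadratic_bound_def numeral_2_eq_2)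
  with P_in[of t] t that show ?thesis by simp
qed

section \<open>The risk of a feasible parameter\<close>

text \<open>The comparison with the constraint is made separately for each obstacle and time
  interval; summing these estimates gives the bound for a single plan.\<close>

lemma feasible_collision_risk:
  fixes E :: "('n::finite, 'i) ego_system"
  assumes reach: "reachability E" and grid: "grids_cover E" and world: "world_space E"
    and z: "z \<in> inits E"
    and feasible: "p \<in> feasible_set (opt_E E \<epsilon> q H z)"
    and q: "\<And>i j. i \<in> obs_index E \<Longrightarrow> j \<in> time_index E \<Longrightarrow>
      (\<forall>w\<in>world E. 0 \<le> q i j w) \<and> twice_differentiable_on (q i j) (world E)"
    and H: "\<And>i j T w a b. i \<in> obs_index E \<Longrightarrow> j \<in> time_index E \<Longrightarrow> T \<in> cover_triangles E j z \<Longrightarrow>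
      w \<in> tri_region T + (\<lambda>p. reach_A E j *v p) ` params E \<Longrightarrow>
      hessian (q i j) w $ a $ b \<le> H i j T $ a $ b"
  shows "collision_risk E q z p \<le> \<epsilon>"
proof -
  have p: "p \<in> params E" using feasible by (simp add: opt_E_def)
  define tri where "tri j T = (\<lambda>x. x + reach_A E j *v p) ` tri_region T" for j T
  define B where "B i j T = quadratic_bound (q i j) (H i j T) (fst T + reach_A E j *v p)" for i j T
  have risk: "(LINT w : (\<Union>t\<in>time_interval E j. occupancy E t z p + zonotope 0 (G_obs E)) | lborel. q i j w)
      \<le> (\<Sum>T\<in>cover_triangles E j z. LINT w : tri j T | lborel. B i j T w)"
    (is "(LINT w : ?U | _. _) \<le> _") if ij: "i \<in> obs_index E" "j \<in> time_index E" for i j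
  proof -
    have cell: "0 \<le> grid_cell E j z $ 1" "0 \<le> grid_cell E j z $ 2" and k: "0 < grid_num E"
      and cover: "zonotope (reach_c E j z) (reach_G E j @ G_obs E) \<subseteq>
        cbox (grid_origin E j z) (grid_origin E j z + real (grid_num E) *\<^sub>R grid_cell E j z)"
      using grid ij z unfolding grids_cover_def by blast+
    \<comment> \<open>The Hessian bounds and the inclusion in the world hold on the region swept by
      a triangle under all parameters; the triangle shifted by the chosen \<open>p\<close> inherits
      both.\<close>
    have tri_sub: "tri j T \<subseteq> tri_region T + (\<lambda>p. reach_A E j *v p) ` params E" for T
      using p by (auto simp: tri_def set_plus_def)
    have bound: "0 \<le> q i j w \<and> q i j w \<le> B i j T w"
      if T: "T \<in> cover_triangles E j z" and w: "w \<in> tri j T" for T w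
    proof -
      have tri_world: "tri j T \<subseteq> world E"
        using world z ij T tri_sub[of T] unfolding world_space_def by blast
      let ?w0 = "fst T + reach_A E j *v p"
      have "?w0 \<in> tri j T" using vertex_in_tri_region by (auto simp: tri_def)
      moreover have "convex (tri j T)"
        unfolding tri_def using convex_translation_eq[of "reach_A E j *v p" "tri_region T"]
        by (simp add: convex_tri_region add.commute)
      \<comment> \<open>Convexity keeps the intermediate point of the Taylor expansion inside the
        shifted triangle, where \<open>H\<close> bounds the Hessian.\<close>
      ultimately have seg: "closed_segment ?w0 w \<subseteq> tri j T"
        using w by (simp add: closed_segment_subset)
      obtain \<xi> where \<xi>: "\<xi> \<in> closed_segment ?w0 w"
        and eq: "q i j w = quadratic_bound (q i j) (hessian (q i j) \<xi>) ?w0 w"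
        by (rule second_order_taylor[OF conjunct2[OF q[OF ij]] subset_trans[OF seg tri_world]])
      obtain x where x: "x \<in> tri_region T" "w = x + reach_A E j *v p"
        using w by (auto simp: tri_def)
      \<comment> \<open>The shift cancels in \<open>w - ?w0\<close>, leaving the displacement inside
        the unshifted triangle.\<close>
      have "0 \<le> (w - ?w0) $ a * (w - ?w0) $ b" for a b
        using grid_triangle_displacement[OF _ cell x(1), of "grid_num E" "grid_origin E j z" a b] T
        by (simp add: x cover_triangles_def)
      moreover have "hessian (q i j) \<xi> $ a $ b \<le> H i j T $ a $ b" for a b
        using H[OF ij T] \<xi> seg tri_sub[of T] by blast
      ultimately have "(w - ?w0) \<bullet> (hessian (q i j) \<xi> *v (w - ?w0)) \<le> (w - ?w0) \<bullet> (H i j T *v (w - ?w0))"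
        by (intro quadratic_form_mono)
      then have "q i j w \<le> B i j T w"
        unfolding eq B_def quadratic_bound_def by linarith
      with q[OF ij] tri_world w show ?thesis by blast
    qed
    have covered: "\<exists>T\<in>cover_triangles E j z. w \<in> tri j T" if "w \<in> ?U" for w
    proof -
      have "occupancy E t z p \<subseteq> reach_set E j z p" if "t \<in> time_interval E j" for t
        using reach z p ij that unfolding reachability_def by blast
      \<comment> \<open>The enlarged reachable set lies in the translate by
        \<open>reach_A E j *v p\<close> of a zonotope that does not depend on \<open>p\<close>, so
        one grid per initial state and time interval covers it for every parameter.\<close>
      then have "?U \<subseteq> reach_set E j z p + zonotope 0 (G_obs E)"
        by (intro UN_least set_plus_mono2) auto
      also have "\<dots> \<subseteq> (\<lambda>x. x + reach_A E j *v p) ` zonotope (reach_c E j z) (reach_G E j @ G_obs E)"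
        unfolding reach_set_def zonotope_translate[symmetric] by (rule zonotope_add_subset)
      finally have "w \<in> \<dots>" using that by (rule subsetD)
      then obtain x where w: "w = x + reach_A E j *v p"
        and x: "x \<in> zonotope (reach_c E j z) (reach_G E j @ G_obs E)"
        by (rule imageE)
      obtain T where "T \<in> grid_triangles (grid_num E) (grid_origin E j z) (grid_cell E j z)"
        "x \<in> tri_region T"
        by (rule cbox_subset_grid_triangles[OF k subsetD[OF cover x]])
      then show ?thesis using x unfolding w tri_def cover_triangles_def by blast
    qed
    have int: "set_integrable lborel (tri j T) (B i j T)" for T
      unfolding set_integrable_def
    proof (rule borel_integrable_compact)
      show "compact (tri j T)"
        unfolding tri_def by (intro compact_continuous_image continuous_intros compact_tri_region)
      show "continuous_on (tri j T) (B i j T)"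
        unfolding B_def quadratic_bound_def
        by (intro continuous_intros matrix_vector_mult_linear_continuous_on[THEN continuous_on_compose2]) auto
    qed
    \<comment> \<open>Triangles may overlap and may stick out of \<open>?U\<close>. All summands are
      nonnegative, so neither can spoil the upper bound.\<close>
    let ?g = "\<lambda>w. \<Sum>T\<in>cover_triangles E j z. indicator (tri j T) w *\<^sub>R B i j T w"
    have term_nonneg: "0 \<le> indicator (tri j T) w *\<^sub>R B i j T w" if "T \<in> cover_triangles E j z" for T w
      using bound[OF that, of w] by (auto simp: indicator_def)
    have le: "indicator ?U w *\<^sub>R q i j w \<le> ?g w" for w
    proof (cases "w \<in> ?U")
      case True
      then obtain T where T: "T \<in> cover_triangles E j z" "w \<in> tri j T" using covered by blast
      then have "q i j w \<le> indicator (tri j T) w *\<^sub>R B i j T w" using bound by simp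
      also have "\<dots> \<le> ?g w"
        by (rule member_le_sum[OF T(1) term_nonneg finite_cover_triangles]) auto
      finally show ?thesis using True by simp
    next
      case False
      then show ?thesis using sum_nonneg[OF term_nonneg] by simp
    qed
    have "(LINT w : ?U | lborel. q i j w) \<le> (LINT w | lborel. ?g w)"
      unfolding set_lebesgue_integral_def
      \<comment> \<open>The left integrand need not be integrable: its integral is then \<open>0\<close>.\<close>
    proof (rule integral_mono')
      show "integrable lborel ?g"
        using int by (intro Bochner_Integration.integrable_sum) (simp add: set_integrable_def)
    qed (rule le, rule sum_nonneg, rule term_nonneg)
    also have "\<dots> = (\<Sum>T\<in>cover_triangles E j z. LINT w : tri j T | lborel. B i j T w)"
      unfolding set_lebesgue_integral_def
      using int by (intro Bochner_Integration.integral_sum) (simp add: set_integrable_def)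
    finally show ?thesis .
  qed
  have "collision_risk E q z p \<le> (\<Sum>i\<in>obs_index E. \<Sum>j\<in>time_index E.
      \<Sum>T\<in>cover_triangles E j z. LINT w : tri j T | lborel. B i j T w)"
    unfolding collision_risk_def by (intro sum_mono risk)
  also have "\<dots> \<le> \<epsilon>"
    using feasible by (simp add: opt_E_def tri_def B_def)
  finally show ?thesis .
qed

section \<open>The timeline of a run\<close>

text \<open>Division with remainder, used with \<open>h = t_m E\<close> to locate a time within a
  driving maneuver.\<close>

lemma nat_multiple_below:
  fixes \<tau> h :: real
  assumes "0 < h" "0 \<le> \<tau>"
  obtains n t where "\<tau> = real n * h + t" "0 \<le> t" "t < h"
proof -
  let ?n = "nat \<lfloor>\<tau> / h\<rfloor>"
  have "real ?n = of_int \<lfloor>\<tau> / h\<rfloor>" using assms by simp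
  then have "real ?n \<le> \<tau> / h" "\<tau> / h < real ?n + 1" by linarith+
  then have "real ?n * h \<le> \<tau>" "\<tau> < (real ?n + 1) * h"
    using assms by (simp_all only: pos_le_divide_eq pos_divide_less_eq)
  then have "0 \<le> \<tau> - real ?n * h" "\<tau> - real ?n * h < h"
    by (simp_all add: distrib_right)
  with that[of ?n "\<tau> - real ?n * h"] show ?thesis by simp
qed

text \<open>Feasibility is tested at the predicted state; exact prediction transfers it to the state
  from which the plan is really executed.\<close>

lemma adopted_plan:
  fixes E :: "('n::finite, 'i) ego_system"
  assumes "reachability E" "grids_cover E" "world_space E" "exact_prediction E R"
    "hessian_bounds E R" "obstacle_predictions E R \<Omega> center" "traj R 0 \<in> inits E"
    and alg: "follows_algorithm E R \<epsilon>" and plan: "plan R n = Some p"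
  shows "traj R (start_time E n) \<in> inits E" "p \<in> params E"
    "collision_risk E (prediction R n) (traj R (start_time E n)) p \<le> \<epsilon>"
proof -
  have "performed R n \<and> predicted_state R n \<in> inits E \<and> p \<in> feasible_set (iteration_problem E R \<epsilon> n)"
  proof (cases n)
    case 0
    then have "performed R n" by (simp add: performed_def)
    moreover have "p \<in> feasible_set (iteration_problem E R \<epsilon> n)"
      using alg plan 0 by (simp add: follows_algorithm_def)
    moreover have "predicted_state R n = traj R 0"
      using assms(4) \<open>performed R n\<close> 0 by (simp add: exact_prediction_def start_time_def)
    ultimately show ?thesis using assms(7) by simp
  next
    case (Suc m)
    \<comment> \<open>A plan at \<open>Suc m\<close> rules out \<open>plan R m = None\<close>, so
      the iteration was performed. Membership of its state in \<open>inits E\<close> is checked by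
      the algorithm itself.\<close>
    then show ?thesis
      using alg plan by (auto simp: follows_algorithm_def performed_def split: if_splits
          dest!: spec[of _ m])
  qed
  then have n: "performed R n" "predicted_state R n \<in> inits E"
    and f: "p \<in> feasible_set (iteration_problem E R \<epsilon> n)" by auto
  have eq: "predicted_state R n = traj R (start_time E n)"
    using assms(4) n(1) by (simp add: exact_prediction_def)
  show "traj R (start_time E n) \<in> inits E" using n eq by simp
  show "p \<in> params E" using f by (simp add: iteration_problem_def opt_E_def)
  show "collision_risk E (prediction R n) (traj R (start_time E n)) p \<le> \<epsilon>"
    unfolding eq[symmetric]
  proof (rule feasible_collision_risk[OF assms(1-3) n(2) f[unfolded iteration_problem_def]])
    show "(\<forall>w\<in>world E. 0 \<le> prediction R n i j w) \<and>
        twice_differentiable_on (prediction R n i j) (world E)"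
      if "i \<in> obs_index E" "j \<in> time_index E" for i j
      using assms(6) n(1) that unfolding obstacle_predictions_def by blast
    show "hessian (prediction R n i j) w $ a $ b \<le> hess_bound R n i j T $ a $ b"
      if "i \<in> obs_index E" "j \<in> time_index E" "T \<in> cover_triangles E j (predicted_state R n)"
        "w \<in> tri_region T + (\<lambda>p. reach_A E j *v p) ` params E" for i j T w a b
      using assms(5) n that unfolding hessian_bounds_def by blast
  qed
qed

text \<open>If the last adopted plan has started by time \<tau>, the vehicle is executing it or
  resting after it. Otherwise every plan started by then has a successor, and \<tau> falls into a
  driving maneuver.\<close>

lemma run_phases:
  fixes E :: "('n::finite, 'i) ego_system"
  assumes time: "timing E" and motion: "vehicle_motion E R" and alg: "follows_algorithm E R \<epsilon>"
    and \<tau>: "0 \<le> \<tau>"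
  obtains "plan R 0 = None"
  | n p where "plan R n = Some p" "executing E R \<tau> n (traj R (start_time E n)) p"
  | n p where "plan R n = Some p" "traj R \<tau> = sol E (t_f E) (traj R (start_time E n)) p"
proof (cases "plan R 0 = None")
  case False
  note cases = that
  have t_m: "0 \<le> t_m E" "t_m E < t_f E" using time by (auto simp: timing_def)
  have drive: "traj R (start_time E n + t) = sol E t (traj R (start_time E n)) p"
    if "plan R n = Some p" "0 \<le> t" "t \<le> t_m E" for n p t
    using motion that by (auto simp: vehicle_motion_def Let_def)
  have brake: "traj R (start_time E n + t) = sol E t (traj R (start_time E n)) p"
    if "plan R n = Some p" "plan R (Suc n) = None" "t_m E \<le> t" "t \<le> t_f E" for n p t
    using motion that by (auto simp: vehicle_motion_def Let_def)
  have rest: "traj R (start_time E n + t) = traj R (start_time E n + t_f E)"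
    if "plan R n = Some p" "plan R (Suc n) = None" "t_f E \<le> t" for n p t
    using motion that unfolding vehicle_motion_def Let_def by blast
  have none: "plan R m = None" if "plan R n = None" "n \<le> m" for n m
    using that(2,1) alg by (induction rule: dec_induct) (auto simp: follows_algorithm_def)
  have driving: thesis if some: "plan R (Suc n) \<noteq> None" and t: "\<tau> = start_time E n + t" "0 \<le> t" "t < t_m E" for n t
  proof -
    have "plan R n \<noteq> None" using none[of n "Suc n"] some by auto
    then obtain p where p: "plan R n = Some p" by auto
    have "executing E R \<tau> n (traj R (start_time E n)) p"
      unfolding executing_def using p some t drive[OF p t(2)] by auto
    with cases(2) p show thesis by blast
  qed
  \<comment> \<open>Without a successor, plan \<open>n\<close> continues into its braking maneuver:
    it is being executed up to \<open>t_f\<close>, and afterwards the state reached there is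
    kept.\<close>
  have last: thesis if some: "plan R n \<noteq> None" and none: "plan R (Suc n) = None"
    and start: "start_time E n \<le> \<tau>" for n
  proof -
    obtain p where p: "plan R n = Some p" using some by auto
    define t where "t = \<tau> - start_time E n"
    have t: "\<tau> = start_time E n + t" "0 \<le> t" using start by (auto simp: t_def)
    show thesis
    proof (cases "t \<le> t_f E")
      case True
      have "traj R \<tau> = sol E t (traj R (start_time E n)) p"
        unfolding t(1) using drive[OF p t(2)] brake[OF p none _ True] by linarith
      then have "executing E R \<tau> n (traj R (start_time E n)) p"
        unfolding executing_def using p none t True by auto
      with cases(2) p show thesis by blast
    next
      case False
      then have "traj R \<tau> = sol E (t_f E) (traj R (start_time E n)) p"
        unfolding t(1) using rest[OF p none, of t] brake[OF p none, of "t_f E"] t_m by simp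
      with cases(3) p show thesis by blast
    qed
  qed
  show thesis
  proof (cases "\<exists>n. plan R n \<noteq> None \<and> plan R (Suc n) = None \<and> start_time E n \<le> \<tau>")
    case True
    then show thesis using last by blast
  next
    case no_last: False
    have continues: "plan R (Suc n) \<noteq> None" if "plan R n \<noteq> None" "start_time E n \<le> \<tau>" for n
      using no_last that by meson
    have t_m_pos: "0 < t_m E"
    proof (rule ccontr)
      assume "\<not> 0 < t_m E"
      with t_m have "t_m E = 0" by simp
      then obtain m where "plan R m = None" using motion by (auto simp: vehicle_motion_def)
      \<comment> \<open>With \<open>t_m E = 0\<close> the run has to leave the loop, so there is a
        last adopted plan. All plans start at time 0, hence this one has started by \<tau>, contrary
        to the case assumption.\<close>
      then obtain n where "plan R n \<noteq> None" "plan R (Suc n) = None"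
        using False by (induction m) auto
      moreover have "start_time E n \<le> \<tau>" using \<open>t_m E = 0\<close> \<tau> by (simp add: start_time_def)
      ultimately show False using continues[of n] by simp
    qed
    then obtain n t where t: "\<tau> = start_time E n + t" "0 \<le> t" "t < t_m E"
      using nat_multiple_below \<tau> unfolding start_time_def by metis
    \<comment> \<open>Plans 0 to \<open>n\<close> all start by \<tau>, so each is followed by
      another one. The instance \<open>m = n\<close> says that plan \<open>n\<close> is replaced at
      the end of its driving maneuver, which is the phase containing \<tau>.\<close>
    have "plan R (Suc m) \<noteq> None" if "m \<le> n" for m
      using that
    proof (induction m)
      case 0
      have "start_time E 0 \<le> \<tau>" using \<tau> by (simp add: start_time_def)
      with False show ?case by (rule continues)
    next
      case (Suc m)
      have "start_time E (Suc m) \<le> start_time E n"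
        unfolding start_time_def using Suc.prems t_m by (intro mult_right_mono) auto
      also have "\<dots> \<le> \<tau>" using t by simp
      finally show ?case using Suc.IH Suc.prems by (intro continues[of "Suc m"]) auto
    qed
    with driving t show thesis by blast
  qed
qed (use that in blast)

section \<open>The safety guarantee for all time\<close>

theorem theorem15:
  fixes E :: "('n::finite, 'i) ego_system"
    and R :: "('n, 'i) planning_run"
    and \<Omega> :: "'o measure"
    and center :: "nat \<Rightarrow> 'i \<Rightarrow> nat \<Rightarrow> 'o \<Rightarrow> real^2"
    and z0 :: "real^6" and \<epsilon> :: real
  assumes "timing E"
    and "dynamics E"
    and "reachability E"
    and "0 < veh_length E" and "0 < veh_width E"
    and "finite (obs_index E)"
    and "grids_cover E"
    and "world_space E"
    and "exact_prediction E R"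
    and "hessian_bounds E R"
    and "sensing E R"
    and "obstacle_predictions E R \<Omega> center"
    and "z0 \<in> inits E" and "stopped z0" and "traj R 0 = z0"
    and "\<epsilon> \<in> {0..1}"
    and "follows_algorithm E R \<epsilon>"
    and "vehicle_motion E R"
  shows "\<forall>\<tau>\<ge>0. stopped (traj R \<tau>) \<or>
    (\<exists>n. \<exists>z\<in>inits E. \<exists>p\<in>params E.
       executing E R \<tau> n z p \<and> collision_risk E (prediction R n) z p \<le> \<epsilon>)"
proof (intro allI impI)
  have "traj R 0 \<in> inits E" using \<open>traj R 0 = z0\<close> \<open>z0 \<in> inits E\<close> by simp
  from adopted_plan[OF \<open>reachability E\<close> \<open>grids_cover E\<close> \<open>world_space E\<close>
      \<open>exact_prediction E R\<close> \<open>hessian_bounds E R\<close> \<open>obstacle_predictions E R \<Omega> center\<close>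
      this \<open>follows_algorithm E R \<epsilon>\<close>]
  have adopted: "traj R (start_time E n) \<in> inits E" "p \<in> params E"
    "collision_risk E (prediction R n) (traj R (start_time E n)) p \<le> \<epsilon>"
    if "plan R n = Some p" for n p
    using that by simp_all
  fix \<tau> :: real assume \<tau>: "0 \<le> \<tau>"
  show "stopped (traj R \<tau>) \<or>
    (\<exists>n. \<exists>z\<in>inits E. \<exists>p\<in>params E.
       executing E R \<tau> n z p \<and> collision_risk E (prediction R n) z p \<le> \<epsilon>)"
  proof (rule run_phases[OF \<open>timing E\<close> \<open>vehicle_motion E R\<close> \<open>follows_algorithm E R \<epsilon>\<close> \<tau>])
    assume "plan R 0 = None"
    moreover have "plan R 0 = None \<longrightarrow> (\<forall>\<tau>\<ge>0. traj R \<tau> = traj R 0)"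
      using \<open>vehicle_motion E R\<close> unfolding vehicle_motion_def by (rule conjunct1)
    ultimately have "traj R \<tau> = traj R 0" using \<tau> by blast
    with \<open>stopped z0\<close> \<open>traj R 0 = z0\<close> show ?thesis by simp
  next
    fix n p assume "plan R n = Some p" "executing E R \<tau> n (traj R (start_time E n)) p"
    with adopted show ?thesis by metis
  next
    fix n p assume "plan R n = Some p" "traj R \<tau> = sol E (t_f E) (traj R (start_time E n)) p"
    \<comment> \<open>The contingency maneuver ends with zero longitudinal speed at
      \<open>t_f\<close>, since the plan starts in \<open>inits E\<close> with a parameter in
      \<open>params E\<close>.\<close>
    with adopted[of n p] \<open>dynamics E\<close> show ?thesis by (simp add: dynamics_def)
  qed
qed

end
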